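(* Let $A, B, E\in\mathbb{C}^{n\times n}$ with $E$ invertible and Hermitian, $A^*EB=O$, and $AB=O=BA$. If the $E$-weighted core-EP inverses $A^{\mathrm{ep},E}$ and $B^{\mathrm{ep},E}$ exist, then $(A+B)^{\mathrm{ep},E}=A^{\mathrm{ep},E}+B^{\mathrm{ep},E}$ and $(A-B)^{\mathrm{ep},E}=A^{\mathrm{ep},E}-B^{\mathrm{ep},E}$.
   Context: $A^*$ is the conjugate transpose of $A$ and $O$ is the zero matrix. The index $\mathrm{ind}(M)$ is the smallest non-negative integer $k$ with $\mathrm{rank}(M^k)=\mathrm{rank}(M^{k+1})$ (with $M^0=I$). For $M\in\mathbb{C}^{n\times n}$ with $\mathrm{ind}(M)=k$ and $E$ invertible Hermitian, the $E$-weighted core-EP inverse $M^{\mathrm{ep},E}$ is the matrix $X\in\mathbb{C}^{n\times n}$, unique when it exists, with $XM^{k+1}=M^k$, $MX^2=X$, $(EMX)^*=EMX$. The equalities in the conclusion are understood to include the assertion that the left-hand sides exist. *)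

theory Defs
  imports
    "Jordan_Normal_Form.Matrix"
    "Jordan_Normal_Form.DL_Rank"
    "Jordan_Normal_Form.Schur_Decomposition"
begin

text \<open>
  Square complex matrices are elements of \<open>carrier_mat n n\<close>; the conjugate transpose is
  \<open>mat_adjoint\<close>. For a square \<open>M\<close>, the ranks of its powers do not increase, so the set of
  exponents in the definition of the index is never empty.
\<close>

definition mat_index :: "complex mat \<Rightarrow> nat" where
  "mat_index M =
     (LEAST k. vec_space.rank (dim_row M) (M ^\<^sub>m k) = vec_space.rank (dim_row M) (M ^\<^sub>m (k + 1)))"

definition hermitian_mat :: "complex mat \<Rightarrow> bool" where
  "hermitian_mat A \<longleftrightarrow> mat_adjoint A = A"

definition is_weighted_core_ep_inverse :: "complex mat \<Rightarrow> complex mat \<Rightarrow> complex mat \<Rightarrow> bool" where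
  "is_weighted_core_ep_inverse E M X \<longleftrightarrow>
     X \<in> carrier_mat (dim_row M) (dim_row M) \<and>
     X * M ^\<^sub>m (mat_index M + 1) = M ^\<^sub>m (mat_index M) \<and>
     M * X ^\<^sub>m 2 = X \<and>
     mat_adjoint (E * M * X) = E * M * X"

definition has_weighted_core_ep_inverse :: "complex mat \<Rightarrow> complex mat \<Rightarrow> bool" where
  "has_weighted_core_ep_inverse E M \<longleftrightarrow> (\<exists>X. is_weighted_core_ep_inverse E M X)"

text \<open>
  For invertible Hermitian \<open>E\<close> the inverse is unique when it exists; if it does not exist, the
  value below is unspecified.
\<close>

definition weighted_core_ep_inverse :: "complex mat \<Rightarrow> complex mat \<Rightarrow> complex mat" where
  "weighted_core_ep_inverse E M = (THE X. is_weighted_core_ep_inverse E M X)"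

end

(*
  Any X with M X^2 = X has its range inside the range of every power of M. Hence, with
  X = A^{ep,E} and Y = B^{ep,E}, AB = BA = O gives AY = BX = O. Since E A X is Hermitian,
  E A X B = X^* (A^* E B) = O, so X B = X A X B = O, and symmetrically Y A = O. All cross
  terms vanish, and X + Y satisfies the three equations for A + B, at first with an exponent
  N beyond both indices. The exponent is lowered to ind(A + B) by writing
  (A + B)^{ind} = (A + B)^{N + ind} W. The difference is the sum of A and -B.
*)
theory Submission
  imports Defs
begin

section \<open>Column spaces and ranks of matrix products\<close>

context vec_space
begin

text \<open>The rank is the dimension of the column space as a vector space of its own. Independence
  in the ambient space carries over to this subspace, where the dimension bounds every independent
  set.\<close>

lemma card_le_rank:
  assumes "A \<in> carrier_mat n nc" and "U \<subseteq> col_space A" and "lin_indpt U"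
  shows "finite U" "card U \<le> rank A"
proof -
  have cols: "set (cols A) \<subseteq> carrier_vec n"
    using assms(1) cols_dim by blast
  interpret W: vectorspace class_ring "vs (col_space A)"
    unfolding col_space_def by (rule subspace_is_vs[OF span_is_subspace[OF cols]])
  have "W.fin_dim"
    unfolding col_space_def by (rule fin_dim_span_cols[OF assms(1)])
  moreover have "W.lin_indpt U"
    using span_li_not_depend(2)[OF assms(2)] assms(3) span_is_submodule[OF cols]
    unfolding col_space_def by blast
  ultimately show "finite U" "card U \<le> rank A"
    using W.li_le_dim[of U] assms(2) unfolding rank_def col_space_def by auto
qed

lemma col_space_mult_subset:
  assumes "A \<in> carrier_mat n nc" and "B \<in> carrier_mat nc m"
  shows "col_space (A * B) \<subseteq> col_space A"
  unfolding col_space_eq[OF assms(1)] col_space_eq[OF mult_carrier_mat[OF assms]]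
  using assms by auto

text \<open>A maximal independent set of columns attains the rank. Only its membership in the column
  space is recorded, so that it can be compared with the column space of another matrix.\<close>

lemma cols_maximal_indpt:
  assumes "A \<in> carrier_mat n nc"
  obtains S where "S \<subseteq> col_space A" "lin_indpt S" "rank A = card S"
proof -
  have "lin_indpt {}"
    by (simp add: lin_dep_def)
  then obtain S where S: "maximal S (\<lambda>T. T \<subseteq> set (cols A) \<and> lin_indpt T)"
    using maximal_exists_superset[of "set (cols A)" "\<lambda>T. T \<subseteq> set (cols A) \<and> lin_indpt T" "{}"] by auto
  have "set (cols A) \<subseteq> carrier_vec n"
    using assms cols_dim by blast
  then have "set (cols A) \<subseteq> col_space A"
    unfolding col_space_def using in_own_span by simp
  with S rank_card_indpt[OF assms S] show thesis
    by (intro that[of S]) (auto simp: maximal_def)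
qed

lemma rank_mult_le:
  assumes "A \<in> carrier_mat n nc" and "B \<in> carrier_mat nc m"
  shows "rank (A * B) \<le> rank A"
proof -
  obtain S where "S \<subseteq> col_space (A * B)" "lin_indpt S" "rank (A * B) = card S"
    using cols_maximal_indpt[OF mult_carrier_mat[OF assms]] .
  then show ?thesis
    using card_le_rank(2)[OF assms(1), of S] col_space_mult_subset[OF assms] by auto
qed

text \<open>If the inclusion were strict, a vector of \<open>col_space A\<close> outside the smaller
  space would enlarge an independent set of size \<open>rank A\<close> by one, against
  \<open>card_le_rank\<close>.\<close>

lemma col_space_mult_eq:
  assumes "A \<in> carrier_mat n nc" and "B \<in> carrier_mat nc m" and "rank (A * B) = rank A"
  shows "col_space (A * B) = col_space A"
proof (rule ccontr)
  have AB: "A * B \<in> carrier_mat n m"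
    using assms by auto
  obtain S where S: "S \<subseteq> col_space (A * B)" "lin_indpt S" "rank (A * B) = card S"
    using cols_maximal_indpt[OF AB] .
  assume "col_space (A * B) \<noteq> col_space A"
  then obtain x where x: "x \<in> col_space A" "x \<notin> col_space (A * B)"
    using col_space_mult_subset[OF assms(1,2)] by auto
  have carrier: "S \<subseteq> carrier_vec n" "x \<in> carrier_vec n"
    using S(1) x(1) assms(1) unfolding col_space_eq[OF assms(1)] col_space_eq[OF AB] by auto
  have "set (cols (A * B)) \<subseteq> carrier_vec n"
    using cols_dim[of "A * B"] carrier_matD(1)[OF AB] by metis
  \<comment> \<open>The span of \<open>S\<close> stays in the space that \<open>x\<close> avoids, so
    adjoining \<open>x\<close> preserves independence.\<close>
  then have "span S \<subseteq> col_space (A * B)"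
    using span_is_subset[OF S(1)[unfolded col_space_def]] span_is_submodule
    unfolding col_space_def by blast
  then have "x \<notin> span S" "x \<notin> S"
    using S(1) x(2) by blast+
  then have "lin_indpt (S \<union> {x})"
    using lin_dep_iff_in_span[of S x] S(2) carrier by simp
  then have "finite (S \<union> {x})" "card (S \<union> {x}) \<le> rank A"
    using card_le_rank[OF assms(1), of "S \<union> {x}"] S(1) x(1) col_space_mult_subset[OF assms(1,2)]
    by auto
  then show False
    using S(3) assms(3) \<open>x \<notin> S\<close> by simp
qed

text \<open>The column spaces agree, so each column of \<open>A\<close> is the image of some vector
  under \<open>A * B\<close>; these vectors are the columns of \<open>W\<close>. This turns the rank
  condition in the index into a matrix identity.\<close>

lemma rank_mult_eq_imp_right_factor:
  assumes "A \<in> carrier_mat n nc" and "B \<in> carrier_mat nc m" and "rank (A * B) = rank A"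
  obtains W where "W \<in> carrier_mat m nc" "A = A * B * W"
proof -
  have AB: "A * B \<in> carrier_mat n m"
    using assms by auto
  have "\<exists>w. w \<in> carrier_vec m \<and> (A * B) *\<^sub>v w = col A j" if "j < nc" for j
  proof -
    have "col A j = A *\<^sub>v unit_vec nc j"
      using assms(1) that by (intro eq_vecI) auto
    then have "col A j \<in> col_space (A * B)"
      using assms(1) that unfolding col_space_mult_eq[OF assms] col_space_eq[OF assms(1)] by auto
    then show ?thesis
      using assms(2) unfolding col_space_eq[OF AB] by auto
  qed
  then obtain w where w: "\<And>j. j < nc \<Longrightarrow> w j \<in> carrier_vec m"
    "\<And>j. j < nc \<Longrightarrow> (A * B) *\<^sub>v w j = col A j"
    by metis
  define W where "W = mat_of_cols m (map w [0..<nc])"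
  have W: "W \<in> carrier_mat m nc" "\<And>j. j < nc \<Longrightarrow> col W j = w j"
    using w(1) by (auto simp: W_def)
  have "A = A * B * W"
  proof (rule mat_col_eqI)
    fix j assume "j < dim_col (A * B * W)"
    then show "col A j = col (A * B * W) j"
      using W(2) w(2) col_mult2[OF AB W(1), of j] carrier_matD(2)[OF W(1)] by (simp del: assoc_mult_mat_vec)
  qed (use assms(1) W(1) in auto)
  with W(1) show thesis
    by (rule that)
qed

end

section \<open>The conjugate transpose\<close>

lemma mat_adjoint_carrier [simp]:
  "A \<in> carrier_mat n m \<Longrightarrow> mat_adjoint A \<in> carrier_mat m n"
  by (auto simp: mat_adjoint_def)

lemma mat_adjoint_index [simp]:
  "i < dim_col A \<Longrightarrow> j < dim_row A \<Longrightarrow> mat_adjoint A $$ (i, j) = conjugate (A $$ (j, i))"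
  by (simp add: mat_adjoint_def mat_of_rows_def)

lemma mat_adjoint_dim [simp]:
  "dim_row (mat_adjoint A) = dim_col A" "dim_col (mat_adjoint A) = dim_row A"
  by (simp_all add: mat_adjoint_def)

lemma mat_adjoint_adjoint [simp]: "mat_adjoint (mat_adjoint A) = A"
  by (rule eq_matI) auto

lemma mat_adjoint_zero [simp]: "mat_adjoint (0\<^sub>m n m) = 0\<^sub>m m n"
  by (rule eq_matI) auto

lemma mat_adjoint_add:
  "A \<in> carrier_mat n m \<Longrightarrow> B \<in> carrier_mat n m \<Longrightarrow>
    mat_adjoint (A + B) = mat_adjoint A + mat_adjoint B"
  by (rule eq_matI) (auto simp: conjugate_dist_add)

lemma mat_adjoint_mult:
  assumes "A \<in> carrier_mat n m" and "B \<in> carrier_mat m k"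
  shows "mat_adjoint (A * B) = mat_adjoint B * mat_adjoint A"
  using assms
  by (intro eq_matI)
     (auto simp: scalar_prod_def sum_conjugate conjugate_dist_mul mult.commute intro!: sum.cong)

section \<open>Powers of square matrices\<close>

lemma pow_mat_Suc_left:
  assumes "A \<in> carrier_mat n n"
  shows "A ^\<^sub>m Suc k = A * A ^\<^sub>m k"
proof (induction k)
  case (Suc k)
  then show ?case
    using assms assoc_mult_mat[of A n n "A ^\<^sub>m k" n A n] by simp
qed (use assms in auto)

lemma pow_mat_add:
  assumes "A \<in> carrier_mat n n"
  shows "A ^\<^sub>m (i + j) = A ^\<^sub>m i * A ^\<^sub>m j"
proof (induction j)
  case (Suc j)
  then show ?case
    using assms assoc_mult_mat[of "A ^\<^sub>m i" n n "A ^\<^sub>m j" n A n] by simp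
qed (use assms in auto)

lemma pow_mat_uminus_even:
  fixes A :: "'a :: ring_1 mat"
  assumes "A \<in> carrier_mat n n"
  shows "(- A) ^\<^sub>m (2 * k) = A ^\<^sub>m (2 * k)"
  using assms by (induction k) (simp_all add: numeral_2_eq_2)

text \<open>All mixed products in the expansion vanish. The exponent must be positive: at exponent 0
  the left side is the identity and the right side twice the identity.\<close>

lemma pow_mat_add_distrib:
  fixes A B :: "'a :: semiring_1 mat"
  assumes A: "A \<in> carrier_mat n n" and B: "B \<in> carrier_mat n n"
    and AB: "A * B = 0\<^sub>m n n" and BA: "B * A = 0\<^sub>m n n"
  shows "(A + B) ^\<^sub>m Suc k = A ^\<^sub>m Suc k + B ^\<^sub>m Suc k"
proof (induction k)
  case (Suc k)
  note carr = A B pow_carrier_mat[OF A] pow_carrier_mat[OF B] mult_carrier_mat[of _ n n _ n]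
  have "A ^\<^sub>m Suc k * B = 0\<^sub>m n n" "B ^\<^sub>m Suc k * A = 0\<^sub>m n n"
    using AB BA assoc_mult_mat[of "A ^\<^sub>m k" n n A n B n]
      assoc_mult_mat[of "B ^\<^sub>m k" n n B n A n] carr by simp_all
  then have "(A ^\<^sub>m Suc k + B ^\<^sub>m Suc k) * (A + B) = A ^\<^sub>m Suc (Suc k) + B ^\<^sub>m Suc (Suc k)"
    by (simp add: carr right_add_zero_mat[of _ n n] left_add_zero_mat[of _ n n]
        add_mult_distrib_mat[of _ n n _ _ n] mult_add_distrib_mat[of _ n n _ n])
  then show ?case
    unfolding pow_mat.simps(2)[of _ "Suc k"] Suc .
qed (use assms in auto)

section \<open>The index and stabilisation of powers\<close>

lemma mat_index_rank_eq:
  assumes M: "M \<in> carrier_mat n n"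
  shows "vec_space.rank n (M ^\<^sub>m mat_index M) = vec_space.rank n (M ^\<^sub>m (mat_index M + 1))"
proof -
  let ?r = "\<lambda>k. vec_space.rank n (M ^\<^sub>m k)"
  have "\<exists>k. ?r k = ?r (k + 1)"
  proof (rule ccontr)
    assume "\<nexists>k. ?r k = ?r (k + 1)"
    moreover have "?r (k + 1) \<le> ?r k" for k
      using vec_space.rank_mult_le[OF pow_carrier_mat[OF M] M, of k] by simp
    ultimately have less: "?r (k + 1) < ?r k" for k
      by (metis le_neq_implies_less)
    \<comment> \<open>Each step would lose at least one from the rank, which is impossible after
      more than \<open>?r 0\<close> steps.\<close>
    have "?r k + k \<le> ?r 0" for k
    proof (induction k)
      case (Suc k)
      then show ?case
        using less[of k] by simp
    qed simp
    from this[of "Suc (?r 0)"] show False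
      by simp
  qed
  then have "?r (LEAST k. ?r k = ?r (k + 1)) = ?r ((LEAST k. ?r k = ?r (k + 1)) + 1)"
    by (rule LeastI_ex)
  then show ?thesis
    using M unfolding mat_index_def by simp
qed

text \<open>Equality of ranks at the index gives a right factor \<open>V\<close> with
  \<open>M^k = M^k M V\<close>. Inserting this identity repeatedly raises the exponent without
  bound.\<close>

lemma pow_mat_index_factor:
  assumes M: "M \<in> carrier_mat n n"
  shows "\<exists>W \<in> carrier_mat n n. M ^\<^sub>m mat_index M = M ^\<^sub>m (j + mat_index M) * W"
proof (induction j)
  case 0
  then show ?case
    using M by (intro bexI[of _ "1\<^sub>m n"]) auto
next
  case (Suc j)
  let ?k = "mat_index M"
  note assoc = assoc_mult_mat[of _ n n _ n _ n]
  note carr = M pow_carrier_mat[OF M] mult_carrier_mat[of _ n n _ n]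
  obtain W where W: "W \<in> carrier_mat n n" "M ^\<^sub>m ?k = M ^\<^sub>m (j + ?k) * W"
    using Suc by blast
  obtain V where V: "V \<in> carrier_mat n n" "M ^\<^sub>m ?k = M ^\<^sub>m ?k * M * V"
    using vec_space.rank_mult_eq_imp_right_factor[OF pow_carrier_mat[OF M] M, of ?k]
      mat_index_rank_eq[OF M] by auto
  have "M ^\<^sub>m ?k = M ^\<^sub>m j * M ^\<^sub>m ?k * W"
    using W(2) pow_mat_add[OF M] by simp
  also have "M ^\<^sub>m j * M ^\<^sub>m ?k * W = M ^\<^sub>m j * (M ^\<^sub>m ?k * M * V) * W"
    using V(2) by simp
  also have "\<dots> = M ^\<^sub>m j * M ^\<^sub>m ?k * M * (V * W)"
    using V(1) W(1) by (simp add: carr assoc)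
  also have "\<dots> = M ^\<^sub>m (Suc j + ?k) * (V * W)"
    using pow_mat_add[OF M, of j ?k] by simp
  finally show ?case
    using V(1) W(1) by (intro bexI[of _ "V * W"]) auto
qed

section \<open>Checking and using the defining equations\<close>

text \<open>Writing \<open>M^k = M^(N+k) W\<close> at the index \<open>k\<close> puts a factor
  \<open>M^N\<close> in reach of the assumed equation, so any exponent \<open>N\<close> will do.
  Sums and negatives can then be treated without computing their index.\<close>

lemma is_weighted_core_ep_inverseI:
  assumes M: "M \<in> carrier_mat n n" and X: "X \<in> carrier_mat n n"
    and pow: "X * M ^\<^sub>m Suc N = M ^\<^sub>m N" and "M * (X * X) = X"
    and "mat_adjoint (E * M * X) = E * M * X"
  shows "is_weighted_core_ep_inverse E M X"
proof -
  let ?k = "mat_index M"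
  note assoc = assoc_mult_mat[of _ n n _ n _ n]
  note carr = M X pow_carrier_mat[OF M] mult_carrier_mat[of _ n n _ n]
  obtain W where W: "W \<in> carrier_mat n n" "M ^\<^sub>m ?k = M ^\<^sub>m (N + ?k) * W"
    using pow_mat_index_factor[OF M] by blast
  have "X * M ^\<^sub>m Suc ?k = X * (M * (M ^\<^sub>m N * M ^\<^sub>m ?k * W))"
    using W(2) pow_mat_Suc_left[OF M, of ?k] pow_mat_add[OF M, of N ?k] by simp
  also have "\<dots> = X * (M * M ^\<^sub>m N) * (M ^\<^sub>m ?k * W)"
    using W(1) by (simp add: carr assoc)
  also have "\<dots> = M ^\<^sub>m N * (M ^\<^sub>m ?k * W)"
    using pow pow_mat_Suc_left[OF M, of N] by simp
  also have "\<dots> = M ^\<^sub>m ?k"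
    using W(1) W(2) pow_mat_add[OF M, of N ?k] by (simp add: carr assoc)
  finally have "X * M ^\<^sub>m (?k + 1) = M ^\<^sub>m ?k"
    by simp
  moreover have "X ^\<^sub>m 2 = X * X"
    using X by (simp add: numeral_2_eq_2)
  ultimately show ?thesis
    using assms unfolding is_weighted_core_ep_inverse_def by (metis carrier_matD(1))
qed

lemma invertible_mat_mult_left_cancel:
  assumes E: "E \<in> carrier_mat n n" and invE: "invertible_mat E"
    and P: "P \<in> carrier_mat n n" and Q: "Q \<in> carrier_mat n n"
    and eq: "E * P = E * Q"
  shows "P = Q"
proof -
  obtain F where F: "E * F = 1\<^sub>m n" "F * E = 1\<^sub>m (dim_row F)"
    using E invE unfolding invertible_mat_def inverts_mat_def by auto
  \<comment> \<open>\<open>invertible_mat\<close> fixes no shape for \<open>F\<close>; its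
    dimensions are read off from the two products with \<open>E\<close>.\<close>
  have "dim_row F = dim_col (F * E)" "dim_col (E * F) = n"
    using F by simp_all
  then have F': "F \<in> carrier_mat n n"
    using E by auto
  have "F * (E * R) = R" if "R \<in> carrier_mat n n" for R
    using F(2) F' that assoc_mult_mat[OF F' E that] by simp
  from this[OF P] this[OF Q] show ?thesis
    using eq by metis
qed

context
  fixes n :: nat and E M X :: "complex mat"
  assumes M: "M \<in> carrier_mat n n" and inv: "is_weighted_core_ep_inverse E M X"
begin

lemma core_ep_carrier: "X \<in> carrier_mat n n"
  using M inv by (auto simp: is_weighted_core_ep_inverse_def)

lemma core_ep_outer: "M * (X * X) = X"
  using core_ep_carrier inv by (auto simp: is_weighted_core_ep_inverse_def numeral_2_eq_2)

lemma core_ep_adjoint: "mat_adjoint (E * M * X) = E * M * X"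
  using inv by (simp add: is_weighted_core_ep_inverse_def)

text \<open>Multiplying the defining equation on the right by \<open>M^j\<close> shifts its
  exponent. This lets two matrices with different indices share one exponent.\<close>

lemma core_ep_pow: "X * M ^\<^sub>m Suc (mat_index M + j) = M ^\<^sub>m (mat_index M + j)"
proof -
  note assoc = assoc_mult_mat[of _ n n _ n _ n]
  have "X * M ^\<^sub>m Suc (mat_index M + j) = X * (M ^\<^sub>m (mat_index M + 1) * M ^\<^sub>m j)"
    using pow_mat_add[OF M, of "mat_index M + 1" j] by simp
  also have "\<dots> = X * M ^\<^sub>m (mat_index M + 1) * M ^\<^sub>m j"
    using assoc[OF core_ep_carrier pow_carrier_mat[OF M] pow_carrier_mat[OF M]] by metis
  also have "\<dots> = M ^\<^sub>m (mat_index M + j)"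
    using inv pow_mat_add[OF M] by (simp add: is_weighted_core_ep_inverse_def)
  finally show ?thesis .
qed

text \<open>The range of \<open>Y\<close> lies in the range of every power of \<open>M\<close>, where \<open>X\<close> inverts \<open>M\<close>.\<close>

lemma core_ep_left_inverse:
  assumes Y: "Y \<in> carrier_mat n n" and outer: "M * (Y * Y) = Y"
  shows "X * (M * Y) = Y"
proof -
  note assoc = assoc_mult_mat[of _ n n _ n _ n]
  note carr = M Y core_ep_carrier pow_carrier_mat[OF M] pow_carrier_mat[OF Y]
    mult_carrier_mat[of _ n n _ n]
  \<comment> \<open>Obtained by substituting \<open>Y = M Y^2\<close> into itself
    repeatedly.\<close>
  have Y_eq: "Y = M ^\<^sub>m j * Y ^\<^sub>m Suc j" for j
  proof (induction j)
    case 0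
    then show ?case
      using M Y by simp
  next
    case (Suc j)
    have "M ^\<^sub>m Suc j * Y ^\<^sub>m Suc (Suc j) = M ^\<^sub>m j * M * (Y * (Y * Y ^\<^sub>m j))"
      unfolding pow_mat_Suc_left[OF Y] by simp
    also have "\<dots> = M ^\<^sub>m j * (M * (Y * Y) * Y ^\<^sub>m j)"
      by (simp add: carr assoc)
    also have "\<dots> = Y"
      using Suc pow_mat_Suc_left[OF Y, of j] outer by simp
    finally show ?case ..
  qed
  let ?k = "mat_index M"
  have "X * (M * Y) = X * (M * (M ^\<^sub>m ?k * Y ^\<^sub>m Suc ?k))"
    using Y_eq[of ?k] by simp
  \<comment> \<open>With \<open>j\<close> equal to the index, \<open>X\<close> now stands next to
    \<open>M^(k+1)\<close> and the defining equation applies.\<close>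
  also have "\<dots> = X * (M * M ^\<^sub>m ?k) * Y ^\<^sub>m Suc ?k"
    using pow_carrier_mat[OF Y, of "Suc ?k"] by (simp add: carr assoc del: pow_mat.simps)
  also have "\<dots> = Y"
    using core_ep_pow[of 0] pow_mat_Suc_left[OF M, of ?k] Y_eq[of ?k] by simp
  finally show ?thesis .
qed

lemma core_ep_mult_eq_zero_left:
  assumes "B \<in> carrier_mat n n" and "B * M = 0\<^sub>m n n"
  shows "B * X = 0\<^sub>m n n"
proof -
  have "B * X = B * (M * (X * X))"
    using core_ep_outer by simp
  also have "\<dots> = B * M * (X * X)"
    using assms(1) M core_ep_carrier by (simp add: assoc_mult_mat[of _ n n _ n _ n])
  finally show ?thesis
    using assms(2) core_ep_carrier by simp
qed

context
  assumes E: "E \<in> carrier_mat n n" and hermE: "hermitian_mat E"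
begin

text \<open>Both \<open>E\<close> and \<open>E M X\<close> are Hermitian, so \<open>M X\<close> is
  self-adjoint for the sesquilinear form given by \<open>E\<close>.\<close>

lemma core_ep_adjoint_weight:
  "mat_adjoint (M * X) * E = E * (M * X)"
proof -
  have "E * M * X = E * (M * X)"
    by (rule assoc_mult_mat[OF E M core_ep_carrier])
  then show ?thesis
    using core_ep_adjoint mat_adjoint_mult[OF E mult_carrier_mat[OF M core_ep_carrier]] hermE
    by (simp add: hermitian_mat_def)
qed

lemma core_ep_mult_eq_zero_right:
  assumes invE: "invertible_mat E" and B: "B \<in> carrier_mat n n"
    and orth: "mat_adjoint M * E * B = 0\<^sub>m n n"
  shows "X * B = 0\<^sub>m n n"
proof -
  note assoc = assoc_mult_mat[of _ n n _ n _ n]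
  note carr = M E B core_ep_carrier mult_carrier_mat[of _ n n _ n]
  have "E * (M * X * B) = mat_adjoint (M * X) * E * B"
    using core_ep_adjoint_weight by (simp add: carr assoc)
  also have "\<dots> = mat_adjoint X * (mat_adjoint M * E * B)"
    using mat_adjoint_mult[OF M core_ep_carrier] by (simp add: carr assoc)
  also have "\<dots> = E * 0\<^sub>m n n"
    using orth by (simp add: carr right_mult_zero_mat[of _ n n])
  finally have zero: "M * X * B = 0\<^sub>m n n"
    by (rule invertible_mat_mult_left_cancel[OF E invE, rotated 2]) (use carr in auto)
  \<comment> \<open>The identity \<open>X M X = X\<close> is \<open>core_ep_left_inverse\<close>
    with \<open>Y\<close> taken to be \<open>X\<close> itself.\<close>
  have "X * B = X * (M * X) * B"
    using core_ep_left_inverse[OF core_ep_carrier core_ep_outer] by simp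
  also have "\<dots> = X * (M * X * B)"
    by (simp add: carr assoc)
  finally show ?thesis
    using zero core_ep_carrier by simp
qed

end

end

text \<open>\<open>M X\<close> and \<open>M Y\<close> are idempotents with the same range, both
  self-adjoint for the form of \<open>E\<close>, so they coincide like orthogonal projections. Then
  \<open>X = X M X = X M Y = Y\<close>.\<close>

lemma weighted_core_ep_inverse_unique:
  assumes M: "M \<in> carrier_mat n n" and E: "E \<in> carrier_mat n n"
    and invE: "invertible_mat E" and hermE: "hermitian_mat E"
    and X: "is_weighted_core_ep_inverse E M X" and Y: "is_weighted_core_ep_inverse E M Y"
  shows "X = Y"
proof -
  note assoc = assoc_mult_mat[of _ n n _ n _ n]
  note cX = core_ep_carrier[OF M X] and cY = core_ep_carrier[OF M Y]
  note carr = M E cX cY mult_carrier_mat[of _ n n _ n]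
  have XMY: "X * (M * Y) = Y" and YMX: "Y * (M * X) = X" and XMX: "X * (M * X) = X"
    using core_ep_left_inverse[OF M X cY core_ep_outer[OF M Y]]
      core_ep_left_inverse[OF M Y cX core_ep_outer[OF M X]]
      core_ep_left_inverse[OF M X cX core_ep_outer[OF M X]] .
  note adjX = core_ep_adjoint_weight[OF M X E hermE]
    and adjY = core_ep_adjoint_weight[OF M Y E hermE]
  have "E * (M * Y) = mat_adjoint (E * (M * Y))"
    using core_ep_adjoint[OF M Y] by (simp add: carr assoc)
  \<comment> \<open>\<open>M X\<close> acts as the identity on the range of \<open>M Y\<close>.
    Inserting it lets the adjoint reverse the product, after which \<open>M Y\<close> is absorbed by
    \<open>M X\<close>.\<close>
  also have "\<dots> = mat_adjoint (E * (M * X) * (M * Y))"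
    using XMY by (simp add: carr assoc)
  also have "\<dots> = mat_adjoint (M * Y) * mat_adjoint (E * (M * X))"
    by (simp add: carr mat_adjoint_mult[of _ n n _ n])
  also have "\<dots> = mat_adjoint (M * Y) * (E * (M * X))"
    using core_ep_adjoint[OF M X] by (simp add: carr assoc)
  also have "\<dots> = mat_adjoint (M * Y) * E * (M * X)"
    by (simp add: carr assoc)
  also have "\<dots> = E * (M * X)"
    using adjY YMX by (simp add: carr assoc)
  finally have "M * Y = M * X"
    by (rule invertible_mat_mult_left_cancel[OF E invE, rotated 2]) (use carr in auto)
  then show ?thesis
    using XMY XMX by metis
qed

lemma weighted_core_ep_inverse_eq:
  assumes "M \<in> carrier_mat n n" and "E \<in> carrier_mat n n"
    and "invertible_mat E" and "hermitian_mat E" and "is_weighted_core_ep_inverse E M X"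
  shows "weighted_core_ep_inverse E M = X"
  unfolding weighted_core_ep_inverse_def
  using assms weighted_core_ep_inverse_unique by blast

section \<open>Negatives, sums and differences\<close>

lemma is_weighted_core_ep_inverse_uminus:
  assumes M: "M \<in> carrier_mat n n" and E: "E \<in> carrier_mat n n"
    and X: "is_weighted_core_ep_inverse E M X"
  shows "is_weighted_core_ep_inverse E (- M) (- X)"
proof (rule is_weighted_core_ep_inverseI[where n = n])
  \<comment> \<open>An even exponent removes the sign from the powers of \<open>- M\<close>, and
    twice the index is large enough for \<open>core_ep_pow\<close>.\<close>
  let ?k = "2 * mat_index M"
  note carr = carrier_matD[OF M] carrier_matD[OF E] carrier_matD[OF core_ep_carrier[OF M X]]
  have "- X * (- M) ^\<^sub>m Suc ?k = X * M ^\<^sub>m Suc ?k"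
    by (simp add: pow_mat_uminus_even[OF M] carr)
  then show "- X * (- M) ^\<^sub>m Suc ?k = (- M) ^\<^sub>m ?k"
    unfolding pow_mat_uminus_even[OF M] using core_ep_pow[OF M X, of "mat_index M"]
    by (simp only: mult_2)
  show "- M * (- X * - X) = - X"
    using core_ep_outer[OF M X] by (simp add: carr)
  show "mat_adjoint (E * - M * - X) = E * - M * - X"
    using core_ep_adjoint[OF M X] by (simp add: carr)
qed (use M core_ep_carrier[OF M X] in auto)

lemma is_weighted_core_ep_inverse_add:
  assumes A: "A \<in> carrier_mat n n" and B: "B \<in> carrier_mat n n" and E: "E \<in> carrier_mat n n"
    and invE: "invertible_mat E" and hermE: "hermitian_mat E"
    and orth: "mat_adjoint A * E * B = 0\<^sub>m n n"
    and AB: "A * B = 0\<^sub>m n n" and BA: "B * A = 0\<^sub>m n n"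
    and X: "is_weighted_core_ep_inverse E A X" and Y: "is_weighted_core_ep_inverse E B Y"
  shows "is_weighted_core_ep_inverse E (A + B) (X + Y)"
proof -
  note assoc = assoc_mult_mat[of _ n n _ n _ n]
  note cX = core_ep_carrier[OF A X] and cY = core_ep_carrier[OF B Y]
  note carr = A B E cX cY pow_carrier_mat[OF A] pow_carrier_mat[OF B]
    mult_carrier_mat[of _ n n _ n] add_carrier_mat[of _ n n]
  note distrib = add_mult_distrib_mat[of _ n n _ _ n] mult_add_distrib_mat[of _ n n _ n]
  \<comment> \<open>Taking adjoints makes the orthogonality hypothesis symmetric in \<open>A\<close>
    and \<open>B\<close>.\<close>
  have "mat_adjoint (mat_adjoint A * E * B) = mat_adjoint B * E * A"
    using A B E hermE
    by (simp add: mat_adjoint_mult[of _ n n _ n] assoc hermitian_mat_def)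
  then have orth': "mat_adjoint B * E * A = 0\<^sub>m n n"
    using orth by simp
  have XB: "X * B = 0\<^sub>m n n"
    by (rule core_ep_mult_eq_zero_right[OF A X E hermE invE B orth])
  have YA: "Y * A = 0\<^sub>m n n"
    by (rule core_ep_mult_eq_zero_right[OF B Y E hermE invE A orth'])
  have AY: "A * Y = 0\<^sub>m n n" and BX: "B * X = 0\<^sub>m n n"
    by (rule core_ep_mult_eq_zero_left[OF B Y A AB], rule core_ep_mult_eq_zero_left[OF A X B BA])
  have XY: "X * Y = 0\<^sub>m n n" and YX: "Y * X = 0\<^sub>m n n"
    by (rule core_ep_mult_eq_zero_left[OF B Y cX XB], rule core_ep_mult_eq_zero_left[OF A X cY YA])
  show ?thesis
  proof (rule is_weighted_core_ep_inverseI[where n = n])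
    let ?k = "mat_index A" and ?l = "mat_index B"
    \<comment> \<open>This exponent is at least both indices, and the \<open>Suc\<close> keeps it
      positive, as \<open>pow_mat_add_distrib\<close> requires.\<close>
    let ?N = "Suc (?k + ?l)"
    have X_pow: "X * A ^\<^sub>m Suc ?N = A ^\<^sub>m ?N" and Y_pow: "Y * B ^\<^sub>m Suc ?N = B ^\<^sub>m ?N"
      using core_ep_pow[OF A X, of "Suc ?l"] core_ep_pow[OF B Y, of "Suc ?k"]
      by (simp_all add: add.commute del: pow_mat.simps)
    have "X * B ^\<^sub>m Suc ?N = X * B * B ^\<^sub>m ?N" "Y * A ^\<^sub>m Suc ?N = Y * A * A ^\<^sub>m ?N"
      using assoc[OF cX B pow_carrier_mat[OF B], of ?N] assoc[OF cY A pow_carrier_mat[OF A], of ?N]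
      unfolding pow_mat_Suc_left[OF A] pow_mat_Suc_left[OF B] by simp_all
    then have "X * B ^\<^sub>m Suc ?N = 0\<^sub>m n n" "Y * A ^\<^sub>m Suc ?N = 0\<^sub>m n n"
      using XB YA A B by (simp_all del: pow_mat.simps)
    then show "(X + Y) * (A + B) ^\<^sub>m Suc ?N = (A + B) ^\<^sub>m ?N"
      unfolding pow_mat_add_distrib[OF A B AB BA]
      using X_pow Y_pow by (simp add: carr distrib del: pow_mat.simps)
    have sq: "(X + Y) * (X + Y) = X * X + Y * Y"
      using XY YX by (simp add: carr distrib)
    have "A * Y * Y = 0\<^sub>m n n" "B * X * X = 0\<^sub>m n n"
      using AY BX cX cY by simp_all
    then have "A * (Y * Y) = 0\<^sub>m n n" "B * (X * X) = 0\<^sub>m n n"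
      by (simp_all add: carr assoc)
    then show "(A + B) * ((X + Y) * (X + Y)) = X + Y"
      unfolding sq using core_ep_outer[OF A X] core_ep_outer[OF B Y] by (simp add: carr distrib)
    \<comment> \<open>The cross terms vanish and leave a sum of two Hermitian matrices.\<close>
    have "E * (A + B) * (X + Y) = E * A * X + E * B * Y"
      using AY BX by (simp add: carr distrib assoc right_mult_zero_mat[of _ n n])
    then show "mat_adjoint (E * (A + B) * (X + Y)) = E * (A + B) * (X + Y)"
      using core_ep_adjoint[OF A X] core_ep_adjoint[OF B Y]
      by (simp add: carr mat_adjoint_add[of _ n n])
  qed (use A B cX cY in auto)
qed

theorem theorem3p35:
  fixes n :: nat and A B E :: "complex mat"
  assumes A: "A \<in> carrier_mat n n" and B: "B \<in> carrier_mat n n" and E: "E \<in> carrier_mat n n"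
    and "invertible_mat E" and "hermitian_mat E"
    and "mat_adjoint A * E * B = 0\<^sub>m n n"
    and "A * B = 0\<^sub>m n n" and "B * A = 0\<^sub>m n n"
    and "has_weighted_core_ep_inverse E A" and "has_weighted_core_ep_inverse E B"
  shows "has_weighted_core_ep_inverse E (A + B) \<and>
         weighted_core_ep_inverse E (A + B) =
           weighted_core_ep_inverse E A + weighted_core_ep_inverse E B \<and>
         has_weighted_core_ep_inverse E (A - B) \<and>
         weighted_core_ep_inverse E (A - B) =
           weighted_core_ep_inverse E A - weighted_core_ep_inverse E B"
proof -
  obtain X Y where X: "is_weighted_core_ep_inverse E A X" and Y: "is_weighted_core_ep_inverse E B Y"
    using assms(9,10) unfolding has_weighted_core_ep_inverse_def by blast
  note cX = core_ep_carrier[OF A X] and cY = core_ep_carrier[OF B Y]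
  have add: "is_weighted_core_ep_inverse E (A + B) (X + Y)"
    by (rule is_weighted_core_ep_inverse_add[OF assms(1-8) X Y])
  \<comment> \<open>The orthogonality and annihilation hypotheses on \<open>B\<close> pass to
    \<open>- B\<close>, whose inverse is \<open>- Y\<close>.\<close>
  have "is_weighted_core_ep_inverse E (A + - B) (X + - Y)"
    using assms X is_weighted_core_ep_inverse_uminus[OF B E Y]
    by (intro is_weighted_core_ep_inverse_add[where n = n]) auto
  then have diff: "is_weighted_core_ep_inverse E (A - B) (X - Y)"
    by (simp add: add_uminus_minus_mat[OF A B] add_uminus_minus_mat[OF cX cY])
  \<comment> \<open>Uniqueness evaluates the definite description at each of the four
    witnesses.\<close>
  note eq = weighted_core_ep_inverse_eq[OF _ E assms(4,5)]
  have "weighted_core_ep_inverse E A = X" "weighted_core_ep_inverse E B = Y"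
    "weighted_core_ep_inverse E (A + B) = X + Y" "weighted_core_ep_inverse E (A - B) = X - Y"
    using eq[OF A X] eq[OF B Y] eq[OF add_carrier_mat[OF B] add]
      eq[OF minus_carrier_mat[OF B] diff] .
  then show ?thesis
    using add diff unfolding has_weighted_core_ep_inverse_def by auto
qed

end
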